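(* Let $\delta\in(0,1)$, let $\hat\rho_1,\dots,\hat\rho_N$ be $N$ samples drawn independently from $\mathbb P^\star$, and set $$\mathcal T=\left[\hat m-(b-a)\sqrt{\tfrac{\log(4/\delta)}{2N}},\ \hat m+(b-a)\sqrt{\tfrac{\log(4/\delta)}{2N}}\right],\qquad \mathcal D=\left[\hat d-(b-a)\sqrt{\tfrac{9\log(4/\delta)}{2N}},\ \hat d+(b-a)\sqrt{\tfrac{9\log(4/\delta)}{2N}}\right].$$ Let $v^\star$ be the optimal value of $$\max_{n\in\mathbb Z_+}\ \inf_{m\in\mathcal T,\ d\in\mathcal D}\ \inf_{\mathbb P\in\mathcal P(m,d)}\mathbb E_{\mathbb P}[c_n(\tilde\rho)]$$ and let $\hat n$ be an optimal threshold (a maximizer) of this problem. Then $$\mathrm{Prob}\left(v^\star\le\mathbb E_{\mathbb P^\star}[c_{\hat n}(\tilde\rho)]\right)\ge1-\delta,$$ where the probability is with respect to the random samples and, in $\mathbb E_{\mathbb P^\star}[c_{\hat n}(\tilde\rho)]$, the expectation is over $\tilde\rho\sim\mathbb P^\star$ with $\hat n$ held fixed.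
   Context: $\mathbb P^\star$ is a (unknown) probability distribution on $[a,b]$, $0\le a<b$. $\hat m=\frac1N\sum_{i=1}^N\hat\rho_i$ and $\hat d=\frac1N\sum_{i=1}^N|\hat\rho_i-\hat m|$ are the empirical mean and empirical mean-absolute deviation. For real $m,d$, $$\mathcal P(m,d)=\{\mathbb P\text{ a Borel probability measure on }[a,b]:\ \mathbb E_{\mathbb P}[\tilde\rho]=m,\ \mathbb E_{\mathbb P}[|\tilde\rho-m|]=d\}.$$ $\mathbb Z_+$ denotes the nonnegative integers. $c_n:[a,b]\to\mathbb R$, $n\in\mathbb Z_+$, are return functions (with well-defined expectations), for instance the social benefit rate function $$f_n(\rho)=R\mu\,\frac{\rho(1-\rho^n)}{1-\rho^{n+1}}-C\left(\frac{\rho}{1-\rho}-\frac{(n+1)\rho^{n+1}}{1-\rho^{n+1}}\right)\ (\rho\ne1),\quad f_n(1)=R\mu\,\frac{n}{n+1}-C\,\frac n2,$$ or the revenue rate function $$r_n(\rho)=(R\mu-Cn)\,\frac{\rho(1-\rho^n)}{1-\rho^{n+1}}\ (\rho\ne1),\quad r_n(1)=(R\mu-Cn)\,\frac{n}{n+1},$$ with constants $R,C,\mu>0$. An infimum over an empty set is $+\infty$. *)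

theory Defs
  imports "HOL-Probability.Probability"
begin

abbreviation interval_borel :: "real \<Rightarrow> real \<Rightarrow> real measure" where
  "interval_borel a b \<equiv> restrict_space borel {a..b}"

definition borel_prob_on :: "real \<Rightarrow> real \<Rightarrow> real measure \<Rightarrow> bool" where
  "borel_prob_on a b P \<longleftrightarrow> prob_space P \<and> sets P = sets (interval_borel a b)"

text \<open>Both integrands below are bounded and measurable on the interval, so the two
  moment constraints never refer to the integral of a non-integrable function.\<close>

definition ambiguity_set :: "real \<Rightarrow> real \<Rightarrow> real \<Rightarrow> real \<Rightarrow> real measure set" where
  "ambiguity_set a b m d =
     {P. borel_prob_on a b P \<and> (\<integral>x. x \<partial>P) = m \<and> (\<integral>x. \<bar>x - m\<bar> \<partial>P) = d}"

definition emp_mean :: "nat \<Rightarrow> (nat \<Rightarrow> real) \<Rightarrow> real" where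
  "emp_mean N x = (\<Sum>i=1..N. x i) / real N"

definition emp_mad :: "nat \<Rightarrow> (nat \<Rightarrow> real) \<Rightarrow> real" where
  "emp_mad N x = (\<Sum>i=1..N. \<bar>x i - emp_mean N x\<bar>) / real N"

definition mean_interval :: "real \<Rightarrow> real \<Rightarrow> real \<Rightarrow> nat \<Rightarrow> (nat \<Rightarrow> real) \<Rightarrow> real set" where
  "mean_interval a b \<delta> N x =
     {emp_mean N x - (b - a) * sqrt (ln (4 / \<delta>) / (2 * real N)) ..
      emp_mean N x + (b - a) * sqrt (ln (4 / \<delta>) / (2 * real N))}"

definition mad_interval :: "real \<Rightarrow> real \<Rightarrow> real \<Rightarrow> nat \<Rightarrow> (nat \<Rightarrow> real) \<Rightarrow> real set" where
  "mad_interval a b \<delta> N x =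
     {emp_mad N x - (b - a) * sqrt (9 * ln (4 / \<delta>) / (2 * real N)) ..
      emp_mad N x + (b - a) * sqrt (9 * ln (4 / \<delta>) / (2 * real N))}"

text \<open>Values are extended reals: an infimum over an empty ambiguity set is \<open>\<infinity>\<close>, and the
  infimum and supremum need not be finite.\<close>

definition worst_case ::
  "real \<Rightarrow> real \<Rightarrow> real \<Rightarrow> nat \<Rightarrow> (nat \<Rightarrow> real \<Rightarrow> real) \<Rightarrow> (nat \<Rightarrow> real) \<Rightarrow> nat \<Rightarrow> ereal" where
  "worst_case a b \<delta> N c x n =
     (INF m\<in>mean_interval a b \<delta> N x. INF d\<in>mad_interval a b \<delta> N x.
        INF P\<in>ambiguity_set a b m d. ereal (\<integral>t. c n t \<partial>P))"

definition opt_value ::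
  "real \<Rightarrow> real \<Rightarrow> real \<Rightarrow> nat \<Rightarrow> (nat \<Rightarrow> real \<Rightarrow> real) \<Rightarrow> (nat \<Rightarrow> real) \<Rightarrow> ereal" where
  "opt_value a b \<delta> N c x = (SUP n. worst_case a b \<delta> N c x n)"

definition optimal_threshold ::
  "real \<Rightarrow> real \<Rightarrow> real \<Rightarrow> nat \<Rightarrow> (nat \<Rightarrow> real \<Rightarrow> real) \<Rightarrow> (nat \<Rightarrow> real) \<Rightarrow> nat \<Rightarrow> bool" where
  "optimal_threshold a b \<delta> N c x n \<longleftrightarrow>
     is_arg_max (worst_case a b \<delta> N c x) (\<lambda>_. True) n"

text \<open>The event whose probability is bounded. It need not be measurable in general: the selection
  \<open>nhat\<close> of a maximizer is an arbitrary function of the outcome, and \<open>c\<close> is only assumed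
  integrable.\<close>

definition good_event ::
  "real \<Rightarrow> real \<Rightarrow> real \<Rightarrow> nat \<Rightarrow> (nat \<Rightarrow> real \<Rightarrow> real) \<Rightarrow> real measure \<Rightarrow>
   'w measure \<Rightarrow> (nat \<Rightarrow> 'w \<Rightarrow> real) \<Rightarrow> ('w \<Rightarrow> nat) \<Rightarrow> 'w set" where
  "good_event a b \<delta> N c Q M \<rho> nhat =
     {\<omega> \<in> space M. opt_value a b \<delta> N c (\<lambda>i. \<rho> i \<omega>) \<le> ereal (\<integral>t. c (nhat \<omega>) t \<partial>Q)}"

end

theory Submission
  imports Defs
begin

text \<open>Outside an event of probability at most \<open>\<delta>\<close>, Hoeffding's inequality puts both the sample
  mean and the average of \<open>\<bar>\<rho>\<^sub>i - m\<bar>\<close> about the true mean \<open>m\<close> within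
  \<open>\<epsilon> = (b - a) sqrt (ln (4/\<delta>) / 2N)\<close> of their expectations. Replacing \<open>m\<close> by the sample mean
  changes the latter average by at most \<open>\<epsilon>\<close>, so the empirical deviation is off by at most
  \<open>2\<epsilon> \<le> 3\<epsilon>\<close>. On that event \<open>Pstar\<close> is feasible for the worst case problem of every
  threshold simultaneously, so the selected threshold may depend on the sample.\<close>

text \<open>The radius is the one at which the two-sided Hoeffding bound equals
  \<open>\<eta>\<close>. A general \<open>g\<close> lets the same lemma serve the identity and the
  absolute deviation. Keeping \<open>S\<close> abstract means that \<open>g\<close> has to be
  bounded only on \<open>space S\<close>, later the interval.\<close>

lemma (in prob_space) Hoeffding_sample_mean:
  fixes X :: "nat \<Rightarrow> 'a \<Rightarrow> 'b" and g :: "'b \<Rightarrow> real"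
  assumes indep: "indep_vars (\<lambda>_. S) X {1..N}"
    and distr: "\<And>i. i \<in> {1..N} \<Longrightarrow> distr M S (X i) = Q"
    and g [measurable]: "g \<in> borel_measurable S"
    and bounds: "\<And>x. x \<in> space S \<Longrightarrow> g x \<in> {l..u}"
    and "l < u" "1 \<le> N" "0 < \<eta>" "\<eta> \<le> 2"
  shows "prob {\<omega> \<in> space M. (u - l) * sqrt (ln (2 / \<eta>) / (2 * real N))
           \<le> \<bar>(\<Sum>i=1..N. g (X i \<omega>)) / real N - (\<integral>x. g x \<partial>Q)\<bar>} \<le> \<eta>"
proof -
  have X: "random_variable S (X i)" if "i \<in> {1..N}" for i
    using indep that unfolding indep_vars_def by blast
  have one: "1 \<in> {1..N}"
    using \<open>1 \<le> N\<close> by simp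
  have gX: "random_variable borel (\<lambda>\<omega>. g (X i \<omega>))" if "i \<in> {1..N}" for i
    using measurable_compose[OF X[OF that] g] .
  have distr_g: "distr M borel (\<lambda>\<omega>. g (X i \<omega>)) = distr Q borel g" if "i \<in> {1..N}" for i
    unfolding distr[OF that, symmetric] by (subst distr_distr[OF g X[OF that]]) (simp add: o_def)
  have mean: "(\<integral>x. g x \<partial>Q) = expectation (\<lambda>\<omega>. g (X 1 \<omega>))"
    unfolding distr[OF one, symmetric] by (rule integral_distr[OF X[OF one] g])
  \<comment> \<open>Identical distribution is stated relative to a reference variable; the first
    sample plays that part, and it exists as \<open>1 \<le> N\<close>.\<close>
  interpret Hoeffding_ineq_iid M "{1..N}" "\<lambda>i \<omega>. g (X i \<omega>)" "\<lambda>\<omega>. g (X 1 \<omega>)" l u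
    "\<integral>x. g x \<partial>Q"
  proof unfold_locales
    show "indep_vars (\<lambda>_. borel) (\<lambda>i \<omega>. g (X i \<omega>)) {1..N}"
      by (rule indep_vars_compose2[OF indep g])
    show "AE \<omega> in M. g (X 1 \<omega>) \<in> {l..u}"
      using measurable_space[OF X[OF one]] bounds by (intro AE_I2) blast
  qed (use gX[OF one] in \<open>simp_all add: mean distr_g[OF one] distr_g\<close>)
  define \<epsilon> where "\<epsilon> = (u - l) * sqrt (ln (2 / \<eta>) / (2 * real N))"
  \<comment> \<open>This is where \<open>\<eta> \<le> 2\<close> enters: squaring
    \<open>\<epsilon>\<close> then undoes the root.\<close>
  have ln_nonneg: "0 \<le> ln (2 / \<eta>)"
    using assms by simp
  have "0 \<le> \<epsilon>"
    using \<open>l < u\<close> ln_nonneg by (simp add: \<epsilon>_def)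
  have "2 * real N * \<epsilon>\<^sup>2 / (u - l)\<^sup>2 = ln (2 / \<eta>)"
    using assms ln_nonneg by (simp add: \<epsilon>_def power_mult_distrib)
  then have "2 * exp (-2 * real N * \<epsilon>\<^sup>2 / (u - l)\<^sup>2) = \<eta>"
    using assms by (simp add: exp_minus)
  then show ?thesis
    using Hoeffding_ineq_abs_ge'[OF \<open>0 \<le> \<epsilon>\<close> \<open>l < u\<close>] one by (auto simp: \<epsilon>_def)
qed

text \<open>By the reverse triangle inequality, moving the centre changes each summand by at most
  the distance between the two centres; averaging keeps this bound.\<close>

lemma emp_mad_shift:
  assumes "1 \<le> N"
  shows "\<bar>emp_mad N x - (\<Sum>i=1..N. \<bar>x i - m\<bar>) / real N\<bar> \<le> \<bar>emp_mean N x - m\<bar>"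
proof -
  have "\<bar>(\<Sum>i=1..N. \<bar>x i - emp_mean N x\<bar>) - (\<Sum>i=1..N. \<bar>x i - m\<bar>)\<bar>
      \<le> (\<Sum>i=1..N. \<bar>\<bar>x i - emp_mean N x\<bar> - \<bar>x i - m\<bar>\<bar>)"
    by (simp add: sum_subtractf[symmetric] sum_abs)
  also have "\<dots> \<le> (\<Sum>i=1..N. \<bar>emp_mean N x - m\<bar>)"
    by (intro sum_mono) linarith
  finally show ?thesis
    using assms by (simp add: emp_mad_def diff_divide_distrib[symmetric] field_simps)
qed

text \<open>Needed to bound the deviation from the true mean by \<open>b - a\<close> on the whole
  interval.\<close>

lemma borel_prob_on_mean_in_interval:
  assumes "borel_prob_on a b P"
  shows "(\<integral>x. x \<partial>P) \<in> {a..b}"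
proof -
  interpret prob_space P
    using assms by (simp add: borel_prob_on_def)
  have sets: "sets P = sets (interval_borel a b)"
    using assms by (simp add: borel_prob_on_def)
  have "space P = {a..b}"
    using sets_eq_imp_space_eq[OF sets] by (simp add: space_restrict_space)
  moreover have "(\<lambda>x. x) \<in> borel_measurable P"
    unfolding measurable_cong_sets[OF sets refl] by (intro measurable_restrict_space1) simp
  ultimately have "integrable P (\<lambda>x. x)"
    by (intro integrable_const_bound[where B = "max \<bar>a\<bar> \<bar>b\<bar>"]) (auto intro!: AE_I2)
  with \<open>space P = {a..b}\<close> show ?thesis
    by (auto intro!: integral_ge_const integral_le_const AE_I2)
qed

lemma worst_case_le:
  assumes "m \<in> mean_interval a b \<delta> N x" "d \<in> mad_interval a b \<delta> N x" "P \<in> ambiguity_set a b m d"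
  shows "worst_case a b \<delta> N c x n \<le> ereal (\<integral>t. c n t \<partial>P)"
  unfolding worst_case_def by (intro INF_lower2[OF assms(1)] INF_lower2[OF assms(2)] INF_lower assms)

lemma opt_value_eq_worst_case:
  assumes "optimal_threshold a b \<delta> N c x n"
  shows "opt_value a b \<delta> N c x = worst_case a b \<delta> N c x n"
  using assms unfolding opt_value_def optimal_threshold_def is_arg_max_def
  by (intro antisym SUP_upper SUP_least) (auto simp: not_less)

theorem theorem4p3:
  fixes a b \<delta> :: real
    and N :: nat
    and Pstar :: "real measure"
    and M :: "'w measure"
    and \<rho> :: "nat \<Rightarrow> 'w \<Rightarrow> real"
    and c :: "nat \<Rightarrow> real \<Rightarrow> real"
    and nhat :: "'w \<Rightarrow> nat"
  assumes "0 \<le> a" and "a < b"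
    and "borel_prob_on a b Pstar"
    and "\<And>n P. borel_prob_on a b P \<Longrightarrow> integrable P (c n)"
    and "0 < \<delta>" and "\<delta> < 1"
    and "1 \<le> N"
    and "prob_space M"
    and "prob_space.indep_vars M (\<lambda>_. interval_borel a b) \<rho> {1..N}"
    and "\<And>i. i \<in> {1..N} \<Longrightarrow> distr M (interval_borel a b) (\<rho> i) = Pstar"
    and "\<And>\<omega>. \<omega> \<in> space M \<Longrightarrow> optimal_threshold a b \<delta> N c (\<lambda>i. \<rho> i \<omega>) (nhat \<omega>)"
  shows "(\<exists>A\<in>sets M. A \<subseteq> good_event a b \<delta> N c Pstar M \<rho> nhat \<and> 1 - \<delta> \<le> measure M A)
       \<and> (good_event a b \<delta> N c Pstar M \<rho> nhat \<in> sets M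
            \<longrightarrow> 1 - \<delta> \<le> measure M (good_event a b \<delta> N c Pstar M \<rho> nhat))"
proof -
  interpret prob_space M by fact
  define m where "m = (\<integral>x. x \<partial>Pstar)"
  define d where "d = (\<integral>x. \<bar>x - m\<bar> \<partial>Pstar)"
  \<comment> \<open>Each of the two bad events gets level \<open>\<delta> / 2\<close>, and 2 divided
    by \<open>\<delta> / 2\<close> is \<open>4 / \<delta>\<close>.\<close>
  define \<epsilon> where "\<epsilon> = (b - a) * sqrt (ln (4 / \<delta>) / (2 * real N))"
  define B1 where "B1 = {\<omega> \<in> space M. \<epsilon> \<le> \<bar>(\<Sum>i=1..N. \<rho> i \<omega>) / real N - m\<bar>}"
  define B2 where "B2 = {\<omega> \<in> space M. \<epsilon> \<le> \<bar>(\<Sum>i=1..N. \<bar>\<rho> i \<omega> - m\<bar>) / real N - d\<bar>}"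
  \<comment> \<open>A measurable set inside the good event, which may itself fail to be
    measurable.\<close>
  define A where "A = space M - (B1 \<union> B2)"
  have m: "m \<in> {a..b}"
    unfolding m_def by (rule borel_prob_on_mean_in_interval[OF assms(3)])
  have meas: "f \<in> borel_measurable (interval_borel a b)" if "f \<in> borel_measurable borel"
    for f :: "real \<Rightarrow> real"
    using that by (rule measurable_restrict_space1)
  have "prob B1 \<le> \<delta> / 2"
    using Hoeffding_sample_mean[OF assms(9,10) meas, of "\<lambda>x. x" a b "\<delta> / 2"] assms(2,5-7)
    by (simp add: B1_def \<epsilon>_def m_def space_restrict_space)
  \<comment> \<open>As \<open>m\<close> lies in the interval, \<open>\<bar>x - m\<bar>\<close>
    ranges over \<open>{0..b - a}\<close>. This range has the same width as before, so the radius is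
    again \<open>\<epsilon>\<close>.\<close>
  moreover have "prob B2 \<le> \<delta> / 2"
    using Hoeffding_sample_mean[OF assms(9,10) meas, of "\<lambda>x. \<bar>x - m\<bar>" 0 "b - a" "\<delta> / 2"]
      assms(2,5-7) m
    by (simp add: B2_def \<epsilon>_def d_def space_restrict_space abs_le_iff)
  moreover have sets: "B1 \<in> events" "B2 \<in> events"
  proof -
    have \<rho> [measurable]: "random_variable borel (\<rho> i)" if "i \<in> {1..N}" for i
    proof -
      have "\<rho> i \<in> measurable M (interval_borel a b)"
        using assms(9) that unfolding indep_vars_def by blast
      \<comment> \<open>Composition with the inclusion of the interval into the reals.\<close>
      from measurable_compose[OF this meas[OF measurable_ident]] show ?thesis
        by simp
    qed
    show "B1 \<in> events" "B2 \<in> events"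
      unfolding B1_def B2_def by measurable
  qed
  ultimately have "prob (B1 \<union> B2) \<le> \<delta>"
    using measure_Un_le[of B1 M B2] by linarith
  then have prob_A: "1 - \<delta> \<le> prob A"
    using sets by (simp add: A_def prob_compl)
  have sets_A: "A \<in> events"
    using sets by (simp add: A_def)
  have radius: "(b - a) * sqrt (9 * ln (4 / \<delta>) / (2 * real N)) = 3 * \<epsilon>"
    by (simp add: \<epsilon>_def real_sqrt_mult real_sqrt_divide)
  have "A \<subseteq> good_event a b \<delta> N c Pstar M \<rho> nhat"
  proof
    fix \<omega> assume "\<omega> \<in> A"
    let ?x = "\<lambda>i. \<rho> i \<omega>"
    have \<omega>: "\<omega> \<in> space M" and mean: "\<bar>emp_mean N ?x - m\<bar> < \<epsilon>"
      and dev: "\<bar>(\<Sum>i=1..N. \<bar>?x i - m\<bar>) / real N - d\<bar> < \<epsilon>"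
      using \<open>\<omega> \<in> A\<close> by (auto simp: A_def B1_def B2_def emp_mean_def not_le)
    have "m \<in> mean_interval a b \<delta> N ?x"
      using mean by (auto simp: mean_interval_def \<epsilon>_def[symmetric])
    \<comment> \<open>The two errors add up to less than \<open>2 * \<epsilon>\<close>, which is
      below \<open>3 * \<epsilon>\<close> because \<open>mean\<close> forces
      \<open>\<epsilon>\<close> to be positive.\<close>
    moreover have "d \<in> mad_interval a b \<delta> N ?x"
      using mean dev emp_mad_shift[OF assms(7), of ?x m]
      unfolding mad_interval_def radius by auto
    moreover have "Pstar \<in> ambiguity_set a b m d"
      using assms(3) by (simp add: ambiguity_set_def m_def d_def)
    ultimately have "worst_case a b \<delta> N c ?x (nhat \<omega>) \<le> ereal (\<integral>t. c (nhat \<omega>) t \<partial>Pstar)"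
      by (rule worst_case_le)
    then show "\<omega> \<in> good_event a b \<delta> N c Pstar M \<rho> nhat"
      using \<omega> opt_value_eq_worst_case[OF assms(11)[OF \<omega>]] by (simp add: good_event_def)
  qed
  then show ?thesis
    using sets_A prob_A by (meson finite_measure_mono order_trans)
qed

end
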